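(* (One-sided completeness.) For every nonempty set $Z$, assertions $\Phi,\Psi:Z\to\mathrm{Mem}\times\mathrm{Mem}\to[0,\infty]$ and statement $C$: if $\models_Z\{\Phi\}\ C\sim\mathtt{skip}\ \{\Psi\}$, then $\vdash_Z\{\Phi\}\ C\sim\mathtt{skip}\ \{\Psi\}$ is derivable in eRHL.
   Context: Language. Fix a countable set $\mathrm{Var}$ of program variables and a countable set $\mathrm{Val}$ of values; a memory is a map $m:\mathrm{Var}\to\mathrm{Val}$, and $\mathrm{Mem}$ is the (discrete) set of memories; $m[x\mapsto v]$ is the update of $m$. For a countable set $A$, a sub-distribution is $d:A\to[0,1]$ with $|d|:=\sum_a d(a)\le1$ (full if $|d|=1$); $\mathbb{E}_d[f]:=\sum_a d(a)f(a)\in[0,\infty]$; $\delta_a$ is the Dirac distribution. Statements: $C ::= \mathtt{skip} \mid x\leftarrow e \mid x \xleftarrow{\$} s \mid C;C \mid \mathtt{if}\ b\ \mathtt{then}\ C\ \mathtt{else}\ C \mid \mathtt{while}\ b\ \mathtt{do}\ C$, with $[\![e]\!]_m\in\mathrm{Val}$, $[\![b]\!]_m\in\{\mathrm{true},\mathrm{false}\}$, $[\![s]\!]_m$ a full distribution on $\mathrm{Val}$. Semantics $[\![C]\!]_m$ (sub-distribution on $\mathrm{Mem}$): $[\![\mathtt{skip}]\!]_m=\delta_m$; $[\![x\leftarrow e]\!]_m=\delta_{m[x\mapsto[\![e]\!]_m]}$; $[\![x\xleftarrow{\$}s]\!]_m$ is the image of $[\![s]\!]_m$ under $v\mapsto m[x\mapsto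 v]$; $[\![C;D]\!]_m=\sum_{m'}[\![C]\!]_m(m')[\![D]\!]_{m'}$; conditionals select a branch by $[\![b]\!]_m$; $[\![\mathtt{while}\ b\ \mathtt{do}\ C]\!]_m=\sup_i[\![\mathtt{while}^i]\!]_m$ with $\mathtt{while}^0$ the zero sub-distribution and $[\![\mathtt{while}^{i+1}]\!]_m=\sum_{m'}[\![C]\!]_m(m')[\![\mathtt{while}^i]\!]_{m'}$ if $[\![b]\!]_m$, else $\delta_m$. $C$ is almost surely terminating (a.s.t.) if $[\![C]\!]_m$ is full for all $m$. Sequencing is taken with $\mathtt{skip}$ as syntactic unit. $\star$-couplings: $A^\star=A\uplus\{\star\}$; $d^\star$ extends $d$ by $d^\star(\star)=1-|d|$; a $\star$-coupling of $d_1,d_2$ is a full distribution on $A_1^\star\times A_2^\star$ with marginals $d_1^\star,d_2^\star$; a coupling of $d_1,d_2$ is a sub-distribution on $A_1\times A_2$ with marginals $d_1,d_2$. Validity: for nonempty $Z$ and $\Phi,\Psi:Z\to\mathrm{Mem}\times\mathrm{Mem}\to[0,\infty]$, $\Psi^\star z(m_1,m_2)=\Psi z(m_1,m_2)$ if $m_1,m_2\in\mathrm{Mem}$, else $0$; $\models_Z\{\Phi\}C\sim D\{\Psi\}$ iff for all $z,m_1,m_2$ some $\star$-coupling $\mu$ of $[\![C]\!]_{m_1},[\![D]\!]_{m_2}$ has $\Phi z(m_1,m_2)\ge\mathbb{E}_\mu[\Psi^\star z]$. For a predicate $P$ on $\mathrm{Mem}\times\mathrm{Mem}$, $P\triangleright\Phi$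 equals $\Phi$ where $P$ holds and $\infty$ elsewhere; $[P]$ is the $0/1$ indicator. Write $b_1:=[\![b]\!]_{m_1}$, $b'_2:=[\![b']\!]_{m_2}$. Deductive system eRHL: $\vdash_Z\{\Phi\}C\sim D\{\Psi\}$ is derivable if obtained by the rules: (Skip) $\vdash_Z\{\Phi\}\mathtt{skip}\sim\mathtt{skip}\{\Phi\}$. (Asgn) $\vdash_Z\{\lambda z(m_1,m_2).\Phi z(m_1[x\mapsto[\![e]\!]_{m_1}],m_2[y\mapsto[\![e']\!]_{m_2}])\}\ x\leftarrow e\sim y\leftarrow e'\ \{\Phi\}$. (Sample) if $\mu(m_1,m_2)$ is a coupling of $[\![s]\!]_{m_1},[\![s']\!]_{m_2}$ for all $m_1,m_2$: $\vdash_Z\{\lambda z(m_1,m_2).\mathbb{E}_{(v_1,v_2)\sim\mu(m_1,m_2)}[\Phi z(m_1[x\mapsto v_1],m_2[y\mapsto v_2])]\}\ x\xleftarrow{\$}s\sim y\xleftarrow{\$}s'\ \{\Phi\}$. (If) from $\vdash_Z\{(b_1\wedge b'_2)\triangleright\Phi\}C_1\sim D_1\{\Psi\}$ and $\vdash_Z\{(\neg b_1\wedge\neg b'_2)\triangleright\Phi\}C_2\sim D_2\{\Psi\}$ infer $\vdash_Z\{(b_1\leftrightarrow b'_2)\triangleright\Phi\}\ \mathtt{if}\ b\ \mathtt{then}\ C_1\ \mathtt{else}\ C_2\sim\mathtt{if}\ b'\ \mathtt{then}\ D_1\ \mathtt{else}\ D_2\ \{\Psi\}$. (While) from $\vdash_Z\{(b_1\wedge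 b'_2)\triangleright\Phi\}C\sim D\{(b_1\leftrightarrow b'_2)\triangleright\Phi\}$ infer $\vdash_Z\{(b_1\leftrightarrow b'_2)\triangleright\Phi\}\ \mathtt{while}\ b\ \mathtt{do}\ C\sim\mathtt{while}\ b'\ \mathtt{do}\ D\ \{(\neg b_1\wedge\neg b'_2)\triangleright\Phi\}$. (Seq) from $\vdash_Z\{\Phi\}C_1\sim D_1\{\Theta\}$ and $\vdash_Z\{\Theta\}C_2\sim D_2\{\Psi\}$ infer $\vdash_Z\{\Phi\}C_1;C_2\sim D_1;D_2\{\Psi\}$ (with $\mathtt{skip}$ as unit). (Asgn-L) $\vdash_Z\{\lambda z(m_1,m_2).\Phi z(m_1[x\mapsto[\![e]\!]_{m_1}],m_2)\}\ x\leftarrow e\sim\mathtt{skip}\ \{\Phi\}$. (Sample-L) $\vdash_Z\{\lambda z(m_1,m_2).\mathbb{E}_{v\sim[\![s]\!]_{m_1}}[\Phi z(m_1[x\mapsto v],m_2)]\}\ x\xleftarrow{\$}s\sim\mathtt{skip}\ \{\Phi\}$. (If-L) from $\vdash_Z\{b_1\triangleright\Phi\}C_1\sim\mathtt{skip}\{\Psi\}$ and $\vdash_Z\{\neg b_1\triangleright\Phi\}C_2\sim\mathtt{skip}\{\Psi\}$ infer $\vdash_Z\{\Phi\}\mathtt{if}\ b\ \mathtt{then}\ C_1\ \mathtt{else}\ C_2\sim\mathtt{skip}\{\Psi\}$. (While-L) from $\vdash_Z\{b_1\triangleright\Phi\}C\sim\mathtt{skip}\{\Phi\}$ infer $\vdash_Z\{\Phi\}\mathtt{while}\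 b\ \mathtt{do}\ C\sim\mathtt{skip}\{\neg b_1\triangleright\Phi\}$. (Conseq) from $\vdash_{Z'}\{\Phi'\}C\sim D\{\Psi'\}$ infer $\vdash_Z\{\Phi\}C\sim D\{\Psi\}$ provided: for all $m_1,m_2\in\mathrm{Mem}$ and sub-distributions $d_1,d_2$ on $\mathrm{Mem}$, if $\Phi'z'(m_1,m_2)\ge\inf_\mu\mathbb{E}_\mu[\Psi'^\star z']$ for all $z'\in Z'$ then $\Phi z(m_1,m_2)\ge\inf_\mu\mathbb{E}_\mu[\Psi^\star z]$ for all $z\in Z$ (infima over $\star$-couplings $\mu$ of $d_1,d_2$). (Nmod-L) if $x$ is not modified by $C$ ($m'(x)=m(x)$ whenever $m'\in\mathrm{supp}[\![C]\!]_m$), from $\vdash_{\mathrm{Val}\times Z}\{\lambda(v,z)(m_1,m_2).(m_1(x)=v)\triangleright\Phi z(m_1,m_2)\}C\sim D\{\lambda(v,z)(m_1,m_2).\Psi z(m_1[x\mapsto v],m_2)\}$ infer $\vdash_Z\{\Phi\}C\sim D\{\Psi\}$. (Strassen) if $C,D$ are a.s.t. and $R_z\subseteq\mathrm{Mem}\times\mathrm{Mem}$ ($z\in Z$), with $R_z(M)=\{m_2\mid\exists m_1\in M,(m_1,m_2)\in R_z\}$, then $\vdash_Z\{\Phi\}C\sim D\{\lambda z(m_1,m_2).[(m_1,m_2)\notin R_z]\}$ and $\vdash_{\mathcal{P}(\mathrm{Mem})\times Z}\{\lambda(M,z)(m_1,m_2).1+\Phi z(m_1,m_2)\}C\sim D\{\lambda(M,z)(m_1,m_2).[m_1\in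 M]+[m_2\notin R_z(M)]\}$ are each inferable from the other. Moreover, Asgn-L, Sample-L, If-L, While-L and Nmod-L have mirrored right versions with the roles of the two programs and of the two memory arguments swapped. *)

theory Defs
  imports "HOL-Probability.SPMF"
begin

type_synonym ('x, 'v) mem = "'x \<Rightarrow> 'v"

text \<open>The expression languages are left abstract: \<^typ>\<open>'e\<close>, \<^typ>\<open>'b\<close>, \<^typ>\<open>'s\<close> are the
  types of expressions, guards and sampling expressions, and the following record collects
  their interpretations.\<close>

record ('x, 'v, 'e, 'b, 's) interp =
  expr_sem :: "'e \<Rightarrow> ('x, 'v) mem \<Rightarrow> 'v"
  guard_sem :: "'b \<Rightarrow> ('x, 'v) mem \<Rightarrow> bool"
  dist_sem :: "'s \<Rightarrow> ('x, 'v) mem \<Rightarrow> 'v pmf"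

text \<open>Since \<open>skip\<close> is a syntactic unit of sequencing, statements are raw syntax trees modulo
  the congruence generated by \<open>skip; C = C\<close> and \<open>C; skip = C\<close>. Sequencing is
  not taken modulo associativity.\<close>

datatype ('x, 'e, 'b, 's) raw_stmt =
    RSkip
  | RAssign 'x 'e
  | RSample 'x 's
  | RSeq "('x, 'e, 'b, 's) raw_stmt" "('x, 'e, 'b, 's) raw_stmt"
  | RCond 'b "('x, 'e, 'b, 's) raw_stmt" "('x, 'e, 'b, 's) raw_stmt"
  | RWhile 'b "('x, 'e, 'b, 's) raw_stmt"

inductive unit_cong :: "('x, 'e, 'b, 's) raw_stmt \<Rightarrow> ('x, 'e, 'b, 's) raw_stmt \<Rightarrow> bool" where
  unitL: "unit_cong (RSeq RSkip C) C"
| unitR: "unit_cong (RSeq C RSkip) C"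
| refl: "unit_cong C C"
| sym: "unit_cong C D \<Longrightarrow> unit_cong D C"
| trans: "unit_cong C D \<Longrightarrow> unit_cong D E \<Longrightarrow> unit_cong C E"
| seq: "unit_cong C C' \<Longrightarrow> unit_cong D D' \<Longrightarrow> unit_cong (RSeq C D) (RSeq C' D')"
| cond: "unit_cong C C' \<Longrightarrow> unit_cong D D' \<Longrightarrow> unit_cong (RCond b C D) (RCond b C' D')"
| while: "unit_cong C C' \<Longrightarrow> unit_cong (RWhile b C) (RWhile b C')"

quotient_type ('x, 'e, 'b, 's) stmt = "('x, 'e, 'b, 's) raw_stmt" / unit_cong
  by (intro equivpI reflpI sympI transpI) (auto intro: unit_cong.intros)

lift_definition Skip :: "('x, 'e, 'b, 's) stmt" is RSkip .

lift_definition Assign :: "'x \<Rightarrow> 'e \<Rightarrow> ('x, 'e, 'b, 's) stmt" is RAssign .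

lift_definition Sample :: "'x \<Rightarrow> 's \<Rightarrow> ('x, 'e, 'b, 's) stmt" is RSample .

lift_definition Seq ::
    "('x, 'e, 'b, 's) stmt \<Rightarrow> ('x, 'e, 'b, 's) stmt \<Rightarrow> ('x, 'e, 'b, 's) stmt" (infixr \<open>;;\<close> 60)
  is RSeq by (rule unit_cong.seq)

lift_definition Cond ::
    "'b \<Rightarrow> ('x, 'e, 'b, 's) stmt \<Rightarrow> ('x, 'e, 'b, 's) stmt \<Rightarrow> ('x, 'e, 'b, 's) stmt"
  is RCond by (rule unit_cong.cond)

lift_definition While :: "'b \<Rightarrow> ('x, 'e, 'b, 's) stmt \<Rightarrow> ('x, 'e, 'b, 's) stmt"
  is RWhile by (rule unit_cong.while)

lemma Skip_Seq [simp]: "Skip ;; C = C"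
  by transfer (rule unit_cong.unitL)

lemma Seq_Skip [simp]: "C ;; Skip = C"
  by transfer (rule unit_cong.unitR)

lemma stmt_induct [case_names Skip Assign Sample Seq Cond While, induct type: stmt]:
  assumes "P Skip"
    and "\<And>x e. P (Assign x e)"
    and "\<And>x s. P (Sample x s)"
    and "\<And>C D. P C \<Longrightarrow> P D \<Longrightarrow> P (C ;; D)"
    and "\<And>b C D. P C \<Longrightarrow> P D \<Longrightarrow> P (Cond b C D)"
    and "\<And>b C. P C \<Longrightarrow> P (While b C)"
  shows "P C"
proof -
  have "P (abs_stmt R)" for R
    by (induction R) (use assms in \<open>simp_all add: Skip.abs_eq [symmetric] Assign.abs_eq [symmetric]
      Sample.abs_eq [symmetric] Seq.abs_eq [symmetric] Cond.abs_eq [symmetric]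
      While.abs_eq [symmetric]\<close>)
  then show ?thesis
    by (metis Quotient3_stmt Quotient3_abs_rep)
qed

text \<open>Sub-distributions are \<^typ>\<open>'a spmf\<close>, that is \<^typ>\<open>'a option pmf\<close>. Hence \<open>A\<^sup>\<star>\<close> is
  \<^typ>\<open>'a option\<close>, \<open>\<star>\<close> is \<^const>\<open>None\<close>, and the completion \<open>d\<^sup>\<star>\<close> of a sub-distribution \<open>d\<close>
  is \<open>d\<close> itself read as a \<^typ>\<open>'a option pmf\<close>.\<close>

primrec while_approx ::
    "('m \<Rightarrow> bool) \<Rightarrow> ('m \<Rightarrow> 'm spmf) \<Rightarrow> nat \<Rightarrow> 'm \<Rightarrow> 'm spmf" where
  "while_approx b c 0 m = return_pmf None"
| "while_approx b c (Suc i) m =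
    (if b m then bind_spmf (c m) (while_approx b c i) else return_spmf m)"

primrec raw_sem ::
    "('x, 'v, 'e, 'b, 's) interp \<Rightarrow> ('x, 'e, 'b, 's) raw_stmt \<Rightarrow> ('x, 'v) mem \<Rightarrow> ('x, 'v) mem spmf"
  where
  "raw_sem I RSkip = return_spmf"
| "raw_sem I (RAssign x e) = (\<lambda>m. return_spmf (m(x := expr_sem I e m)))"
| "raw_sem I (RSample x s) = (\<lambda>m. map_spmf (\<lambda>v. m(x := v)) (spmf_of_pmf (dist_sem I s m)))"
| "raw_sem I (RSeq C D) = (\<lambda>m. bind_spmf (raw_sem I C m) (raw_sem I D))"
| "raw_sem I (RCond b C D) = (\<lambda>m. if guard_sem I b m then raw_sem I C m else raw_sem I D m)"
| "raw_sem I (RWhile b C) =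
    (\<lambda>m. lub_spmf (range (\<lambda>i. while_approx (guard_sem I b) (raw_sem I C) i m)))"

lift_definition sem ::
    "('x, 'v, 'e, 'b, 's) interp \<Rightarrow> ('x, 'e, 'b, 's) stmt \<Rightarrow> ('x, 'v) mem \<Rightarrow> ('x, 'v) mem spmf"
  is raw_sem
proof -
  fix I :: "('x, 'v, 'e, 'b, 's) interp" and C D
  show "unit_cong C D \<Longrightarrow> raw_sem I C = raw_sem I D"
    by (induction rule: unit_cong.induct) auto
qed

lemma sem_simps [simp]:
  "sem I Skip m = return_spmf m"
  "sem I (Assign x e) m = return_spmf (m(x := expr_sem I e m))"
  "sem I (Sample x s) m = map_spmf (\<lambda>v. m(x := v)) (spmf_of_pmf (dist_sem I s m))"
  "sem I (C ;; D) m = bind_spmf (sem I C m) (sem I D)"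
  "sem I (Cond b C D) m = (if guard_sem I b m then sem I C m else sem I D m)"
  by (transfer; simp)+

lemma sem_While:
  "sem I (While b C) m =
    lub_spmf (range (\<lambda>i. while_approx (guard_sem I b) (sem I C) i m))"
  by transfer simp

definition ast :: "('x, 'v, 'e, 'b, 's) interp \<Rightarrow> ('x, 'e, 'b, 's) stmt \<Rightarrow> bool" where
  "ast I C \<longleftrightarrow> (\<forall>m. lossless_spmf (sem I C m))"

definition not_modified ::
    "('x, 'v, 'e, 'b, 's) interp \<Rightarrow> 'x \<Rightarrow> ('x, 'e, 'b, 's) stmt \<Rightarrow> bool" where
  "not_modified I x C \<longleftrightarrow> (\<forall>m. \<forall>m' \<in> set_spmf (sem I C m). m' x = m x)"

definition coupling :: "('a \<times> 'b) spmf \<Rightarrow> 'a spmf \<Rightarrow> 'b spmf \<Rightarrow> bool" where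
  "coupling \<mu> d\<^sub>1 d\<^sub>2 \<longleftrightarrow> map_spmf fst \<mu> = d\<^sub>1 \<and> map_spmf snd \<mu> = d\<^sub>2"

definition star_coupling :: "('a option \<times> 'b option) pmf \<Rightarrow> 'a spmf \<Rightarrow> 'b spmf \<Rightarrow> bool" where
  "star_coupling \<mu> d\<^sub>1 d\<^sub>2 \<longleftrightarrow> map_pmf fst \<mu> = d\<^sub>1 \<and> map_pmf snd \<mu> = d\<^sub>2"

fun star_ext :: "('a \<times> 'b \<Rightarrow> ennreal) \<Rightarrow> 'a option \<times> 'b option \<Rightarrow> ennreal" where
  "star_ext f (Some a, Some b) = f (a, b)"
| "star_ext f _ = 0"

definition star_expectation ::
    "('a option \<times> 'b option) pmf \<Rightarrow> ('a \<times> 'b \<Rightarrow> ennreal) \<Rightarrow> ennreal" where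
  "star_expectation \<mu> f = (\<integral>\<^sup>+ p. star_ext f p \<partial>measure_pmf \<mu>)"

type_synonym ('z, 'x, 'v) assertion = "'z \<Rightarrow> ('x, 'v) mem \<times> ('x, 'v) mem \<Rightarrow> ennreal"

definition valid ::
    "('x, 'v, 'e, 'b, 's) interp \<Rightarrow> 'z set \<Rightarrow> ('z, 'x, 'v) assertion \<Rightarrow>
      ('x, 'e, 'b, 's) stmt \<Rightarrow> ('x, 'e, 'b, 's) stmt \<Rightarrow> ('z, 'x, 'v) assertion \<Rightarrow> bool" where
  "valid I Z \<Phi> C D \<Psi> \<longleftrightarrow>
    (\<forall>z \<in> Z. \<forall>m\<^sub>1 m\<^sub>2. \<exists>\<mu>. star_coupling \<mu> (sem I C m\<^sub>1) (sem I D m\<^sub>2) \<and>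
      \<Phi> z (m\<^sub>1, m\<^sub>2) \<ge> star_expectation \<mu> (\<Psi> z))"

definition restrict_to ::
    "('m \<times> 'm \<Rightarrow> bool) \<Rightarrow> ('z \<Rightarrow> 'm \<times> 'm \<Rightarrow> ennreal) \<Rightarrow> 'z \<Rightarrow> 'm \<times> 'm \<Rightarrow> ennreal"
    (infixr \<open>\<triangleright>\<close> 65) where
  "(P \<triangleright> \<Phi>) z m = (if P m then \<Phi> z m else \<infinity>)"

text \<open>The rules relate judgements over different index sets: \<open>Z\<close>, \<open>Val \<times> Z\<close>, \<open>\<P>(Mem) \<times> Z\<close>, and
  an arbitrary \<open>Z'\<close> in the consequence rule. For a single inductive predicate to range over all
  of them, index sets are subsets of a universe that contains an arbitrary type \<^typ>\<open>'u\<close> of atomic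
  indices and is closed under pairing with values and with sets of memories.\<close>

datatype ('x, 'v, 'u) index =
    Atom 'u
  | ValPair (val_of: 'v) (rest_of: "('x, 'v, 'u) index")
  | MemPair (mems_of: "('x, 'v) mem set") (rest_of: "('x, 'v, 'u) index")

definition val_times :: "('x, 'v, 'u) index set \<Rightarrow> ('x, 'v, 'u) index set" where
  "val_times Z = {ValPair v z | v z. z \<in> Z}"

definition mem_pow_times :: "('x, 'v, 'u) index set \<Rightarrow> ('x, 'v, 'u) index set" where
  "mem_pow_times Z = {MemPair M z | M z. z \<in> Z}"

inductive erhl ::
    "('x, 'v, 'e, 'b, 's) interp \<Rightarrow> ('x, 'v, 'u) index set \<Rightarrow>
      (('x, 'v, 'u) index, 'x, 'v) assertion \<Rightarrow> ('x, 'e, 'b, 's) stmt \<Rightarrow> ('x, 'e, 'b, 's) stmt \<Rightarrow>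
      (('x, 'v, 'u) index, 'x, 'v) assertion \<Rightarrow> bool"
  for I :: "('x, 'v, 'e, 'b, 's) interp" where
  Skip:
    "erhl I Z \<Phi> Skip Skip \<Phi>"
    if "Z \<noteq> {}"
| Asgn:
    "erhl I Z (\<lambda>z (m\<^sub>1, m\<^sub>2). \<Phi> z (m\<^sub>1(x := expr_sem I e m\<^sub>1), m\<^sub>2(y := expr_sem I e' m\<^sub>2)))
      (Assign x e) (Assign y e') \<Phi>"
    if "Z \<noteq> {}"
| Sample:
    "erhl I Z (\<lambda>z (m\<^sub>1, m\<^sub>2). \<integral>\<^sup>+ (v\<^sub>1, v\<^sub>2). \<Phi> z (m\<^sub>1(x := v\<^sub>1), m\<^sub>2(y := v\<^sub>2)) \<partial>measure_spmf (\<mu> m\<^sub>1 m\<^sub>2))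
      (Sample x s) (Sample y s') \<Phi>"
    if "Z \<noteq> {}"
      and "\<And>m\<^sub>1 m\<^sub>2. coupling (\<mu> m\<^sub>1 m\<^sub>2) (spmf_of_pmf (dist_sem I s m\<^sub>1)) (spmf_of_pmf (dist_sem I s' m\<^sub>2))"
| If:
    "erhl I Z ((\<lambda>(m\<^sub>1, m\<^sub>2). guard_sem I b m\<^sub>1 \<longleftrightarrow> guard_sem I b' m\<^sub>2) \<triangleright> \<Phi>)
      (Cond b C\<^sub>1 C\<^sub>2) (Cond b' D\<^sub>1 D\<^sub>2) \<Psi>"
    if "erhl I Z ((\<lambda>(m\<^sub>1, m\<^sub>2). guard_sem I b m\<^sub>1 \<and> guard_sem I b' m\<^sub>2) \<triangleright> \<Phi>) C\<^sub>1 D\<^sub>1 \<Psi>"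
      and "erhl I Z ((\<lambda>(m\<^sub>1, m\<^sub>2). \<not> guard_sem I b m\<^sub>1 \<and> \<not> guard_sem I b' m\<^sub>2) \<triangleright> \<Phi>) C\<^sub>2 D\<^sub>2 \<Psi>"
| While:
    "erhl I Z ((\<lambda>(m\<^sub>1, m\<^sub>2). guard_sem I b m\<^sub>1 \<longleftrightarrow> guard_sem I b' m\<^sub>2) \<triangleright> \<Phi>)
      (While b C) (While b' D)
      ((\<lambda>(m\<^sub>1, m\<^sub>2). \<not> guard_sem I b m\<^sub>1 \<and> \<not> guard_sem I b' m\<^sub>2) \<triangleright> \<Phi>)"
    if "erhl I Z ((\<lambda>(m\<^sub>1, m\<^sub>2). guard_sem I b m\<^sub>1 \<and> guard_sem I b' m\<^sub>2) \<triangleright> \<Phi>) C D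
      ((\<lambda>(m\<^sub>1, m\<^sub>2). guard_sem I b m\<^sub>1 \<longleftrightarrow> guard_sem I b' m\<^sub>2) \<triangleright> \<Phi>)"
| Seq:
    "erhl I Z \<Phi> (C\<^sub>1 ;; C\<^sub>2) (D\<^sub>1 ;; D\<^sub>2) \<Psi>"
    if "erhl I Z \<Phi> C\<^sub>1 D\<^sub>1 \<Theta>" and "erhl I Z \<Theta> C\<^sub>2 D\<^sub>2 \<Psi>"
| AsgnL:
    "erhl I Z (\<lambda>z (m\<^sub>1, m\<^sub>2). \<Phi> z (m\<^sub>1(x := expr_sem I e m\<^sub>1), m\<^sub>2)) (Assign x e) Skip \<Phi>"
    if "Z \<noteq> {}"
| AsgnR:
    "erhl I Z (\<lambda>z (m\<^sub>1, m\<^sub>2). \<Phi> z (m\<^sub>1, m\<^sub>2(x := expr_sem I e m\<^sub>2))) Skip (Assign x e) \<Phi>"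
    if "Z \<noteq> {}"
| SampleL:
    "erhl I Z (\<lambda>z (m\<^sub>1, m\<^sub>2). \<integral>\<^sup>+ v. \<Phi> z (m\<^sub>1(x := v), m\<^sub>2) \<partial>measure_pmf (dist_sem I s m\<^sub>1))
      (Sample x s) Skip \<Phi>"
    if "Z \<noteq> {}"
| SampleR:
    "erhl I Z (\<lambda>z (m\<^sub>1, m\<^sub>2). \<integral>\<^sup>+ v. \<Phi> z (m\<^sub>1, m\<^sub>2(x := v)) \<partial>measure_pmf (dist_sem I s m\<^sub>2))
      Skip (Sample x s) \<Phi>"
    if "Z \<noteq> {}"
| IfL:
    "erhl I Z \<Phi> (Cond b C\<^sub>1 C\<^sub>2) Skip \<Psi>"
    if "erhl I Z ((\<lambda>(m\<^sub>1, m\<^sub>2). guard_sem I b m\<^sub>1) \<triangleright> \<Phi>) C\<^sub>1 Skip \<Psi>"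
      and "erhl I Z ((\<lambda>(m\<^sub>1, m\<^sub>2). \<not> guard_sem I b m\<^sub>1) \<triangleright> \<Phi>) C\<^sub>2 Skip \<Psi>"
| IfR:
    "erhl I Z \<Phi> Skip (Cond b D\<^sub>1 D\<^sub>2) \<Psi>"
    if "erhl I Z ((\<lambda>(m\<^sub>1, m\<^sub>2). guard_sem I b m\<^sub>2) \<triangleright> \<Phi>) Skip D\<^sub>1 \<Psi>"
      and "erhl I Z ((\<lambda>(m\<^sub>1, m\<^sub>2). \<not> guard_sem I b m\<^sub>2) \<triangleright> \<Phi>) Skip D\<^sub>2 \<Psi>"
| WhileL:
    "erhl I Z \<Phi> (While b C) Skip ((\<lambda>(m\<^sub>1, m\<^sub>2). \<not> guard_sem I b m\<^sub>1) \<triangleright> \<Phi>)"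
    if "erhl I Z ((\<lambda>(m\<^sub>1, m\<^sub>2). guard_sem I b m\<^sub>1) \<triangleright> \<Phi>) C Skip \<Phi>"
| WhileR:
    "erhl I Z \<Phi> Skip (While b D) ((\<lambda>(m\<^sub>1, m\<^sub>2). \<not> guard_sem I b m\<^sub>2) \<triangleright> \<Phi>)"
    if "erhl I Z ((\<lambda>(m\<^sub>1, m\<^sub>2). guard_sem I b m\<^sub>2) \<triangleright> \<Phi>) Skip D \<Phi>"
| Conseq:
    "erhl I Z \<Phi> C D \<Psi>"
    if "Z \<noteq> {}" and "erhl I Z' \<Phi>' C D \<Psi>'"
      and "\<And>m\<^sub>1 m\<^sub>2 (d\<^sub>1 :: ('x, 'v) mem spmf) (d\<^sub>2 :: ('x, 'v) mem spmf).
        (\<forall>z' \<in> Z'. \<Phi>' z' (m\<^sub>1, m\<^sub>2) \<ge>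
          (INF \<mu> \<in> {\<mu>. star_coupling \<mu> d\<^sub>1 d\<^sub>2}. star_expectation \<mu> (\<Psi>' z'))) \<longrightarrow>
        (\<forall>z \<in> Z. \<Phi> z (m\<^sub>1, m\<^sub>2) \<ge>
          (INF \<mu> \<in> {\<mu>. star_coupling \<mu> d\<^sub>1 d\<^sub>2}. star_expectation \<mu> (\<Psi> z)))"
| NmodL:
    "erhl I Z \<Phi> C D \<Psi>"
    if "not_modified I x C"
      and "erhl I (val_times Z)
        (\<lambda>w (m\<^sub>1, m\<^sub>2). ((\<lambda>(m\<^sub>1, m\<^sub>2). m\<^sub>1 x = val_of w) \<triangleright> \<Phi>) (rest_of w) (m\<^sub>1, m\<^sub>2))
        C D (\<lambda>w (m\<^sub>1, m\<^sub>2). \<Psi> (rest_of w) (m\<^sub>1(x := val_of w), m\<^sub>2))"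
| NmodR:
    "erhl I Z \<Phi> C D \<Psi>"
    if "not_modified I x D"
      and "erhl I (val_times Z)
        (\<lambda>w (m\<^sub>1, m\<^sub>2). ((\<lambda>(m\<^sub>1, m\<^sub>2). m\<^sub>2 x = val_of w) \<triangleright> \<Phi>) (rest_of w) (m\<^sub>1, m\<^sub>2))
        C D (\<lambda>w (m\<^sub>1, m\<^sub>2). \<Psi> (rest_of w) (m\<^sub>1, m\<^sub>2(x := val_of w)))"
| Strassen1:
    "erhl I Z \<Phi> C D (\<lambda>z (m\<^sub>1, m\<^sub>2). of_bool ((m\<^sub>1, m\<^sub>2) \<notin> R z))"
    if "ast I C" and "ast I D"
      and "erhl I (mem_pow_times Z) (\<lambda>w (m\<^sub>1, m\<^sub>2). 1 + \<Phi> (rest_of w) (m\<^sub>1, m\<^sub>2)) C D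
        (\<lambda>w (m\<^sub>1, m\<^sub>2). of_bool (m\<^sub>1 \<in> mems_of w) + of_bool (m\<^sub>2 \<notin> R (rest_of w) `` mems_of w))"
| Strassen2:
    "erhl I (mem_pow_times Z) (\<lambda>w (m\<^sub>1, m\<^sub>2). 1 + \<Phi> (rest_of w) (m\<^sub>1, m\<^sub>2)) C D
      (\<lambda>w (m\<^sub>1, m\<^sub>2). of_bool (m\<^sub>1 \<in> mems_of w) + of_bool (m\<^sub>2 \<notin> R (rest_of w) `` mems_of w))"
    if "ast I C" and "ast I D"
      and "erhl I Z \<Phi> C D (\<lambda>z (m\<^sub>1, m\<^sub>2). of_bool ((m\<^sub>1, m\<^sub>2) \<notin> R z))"

lemma erhl_nonempty: "erhl I Z \<Phi> C D \<Psi> \<Longrightarrow> Z \<noteq> {}"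
  by (induction rule: erhl.induct) (auto simp: val_times_def mem_pow_times_def)

end

theory Submission
  imports Defs
begin

text \<open>
  A star-coupling with the Dirac distribution at \<open>m\<^sub>2\<close> is determined by its first marginal, so
  validity of \<open>{\<Phi>} C \<sim> skip {\<Psi>}\<close> says exactly that \<open>\<Phi>\<close> dominates the weakest pre-expectation
  of \<open>\<Psi>\<close> with \<open>m\<^sub>2\<close> frozen. The weakest pre-expectation is derivable by induction on \<open>C\<close>; for
  loops it is itself the invariant, since it is a fixed point of the unfolding.
\<close>

text \<open>Integrating against \<open>measure_spmf\<close> drops the missing mass, which matches
  \<open>star_ext\<close> being 0 as soon as one component is \<open>None\<close>.\<close>

definition wp_left ::
    "('x, 'v, 'e, 'b, 's) interp \<Rightarrow> ('x, 'e, 'b, 's) stmt \<Rightarrow> ('z, 'x, 'v) assertion \<Rightarrow>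
      ('z, 'x, 'v) assertion" where
  "wp_left I C \<Psi> z = (\<lambda>(m\<^sub>1, m\<^sub>2). \<integral>\<^sup>+ m. \<Psi> z (m, m\<^sub>2) \<partial>measure_spmf (sem I C m\<^sub>1))"

lemma nn_integral_bind_spmf:
  "(\<integral>\<^sup>+ x. f x \<partial>measure_spmf (bind_spmf p g)) =
    (\<integral>\<^sup>+ y. \<integral>\<^sup>+ x. f x \<partial>measure_spmf (g y) \<partial>measure_spmf p)"
  by (simp add: measure_spmf_bind o_def nn_integral_bind[where B = "count_space UNIV"]
      measurable_def space_measure_spmf)

lemma nn_integral_return_spmf:
  "(\<integral>\<^sup>+ x. f x \<partial>measure_spmf (return_spmf a)) = f a"
  by (simp add: measure_spmf_return_spmf nn_integral_return)

lemma while_approx_Suc_mono: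
  "ord_spmf (=) (while_approx b c i m) (while_approx b c (Suc i) m)"
proof (induction i arbitrary: m)
  case (Suc i)
  then show ?case
    by (auto intro!: bind_spmf_mono' ord_spmf_reflI simp del: while_approx.simps(2)
        simp: while_approx.simps(2)[of b c i] while_approx.simps(2)[of b c "Suc i"])
qed simp

text \<open>Makes the approximants a chain, as the facts on \<open>lub_spmf\<close> require, and
  gives the monotonicity needed to exchange \<open>bind_spmf\<close> with the supremum.\<close>

lemma while_approx_mono:
  "monotone (\<le>) (ord_spmf (=)) (\<lambda>i. while_approx b c i m)"
proof (rule monotoneI)
  fix i j :: nat
  assume "i \<le> j"
  then show "ord_spmf (=) (while_approx b c i m) (while_approx b c j m)"
  proof (induction rule: dec_induct)
    case (step n)
    then show ?case
      by (metis spmf.leq_trans while_approx_Suc_mono)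
  qed (simp add: ord_spmf_reflI)
qed

lemma chain_nat: "Complete_Partial_Order.chain (\<le>) (A :: nat set)"
  by (auto simp: chain_def)

text \<open>Shifting the approximants by one keeps their supremum, and \<open>bind_spmf\<close> is
  continuous in its continuation.\<close>

lemma sem_While_unfold:
  "sem I (While b C) m =
    (if guard_sem I b m then bind_spmf (sem I C m) (sem I (While b C)) else return_spmf m)"
proof -
  let ?w = "while_approx (guard_sem I b) (sem I C)"
  have chain: "Complete_Partial_Order.chain (ord_spmf (=)) (range (\<lambda>i. ?w i m))"
    using chain_nat by (rule chain_imageI) (rule monotoneD[OF while_approx_mono])
  have chain': "Complete_Partial_Order.chain (ord_spmf (=)) (range (\<lambda>i. ?w (Suc i) m))"
    by (rule chain_subset[OF chain]) (auto simp del: while_approx.simps)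
  have "lub_spmf (range (\<lambda>i. ?w i m)) = lub_spmf (range (\<lambda>i. ?w (Suc i) m))"
  proof (rule spmf.leq_antisym)
    show "ord_spmf (=) (lub_spmf (range (\<lambda>i. ?w i m))) (lub_spmf (range (\<lambda>i. ?w (Suc i) m)))"
    proof (rule lub_spmf_least[OF chain])
      fix p assume "p \<in> range (\<lambda>i. ?w i m)"
      then obtain i where "p = ?w i m" by auto
      then show "ord_spmf (=) p (lub_spmf (range (\<lambda>i. ?w (Suc i) m)))"
        by (metis spmf.leq_trans while_approx_Suc_mono lub_spmf_upper[OF chain'] rangeI)
    qed
    show "ord_spmf (=) (lub_spmf (range (\<lambda>i. ?w (Suc i) m))) (lub_spmf (range (\<lambda>i. ?w i m)))"
      by (rule lub_spmf_least[OF chain']) (auto intro!: lub_spmf_upper[OF chain] simp del: while_approx.simps)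
  qed
  \<comment> \<open>After the shift, every approximant unfolds by the same clause. If the guard
    fails, the family is constant and its supremum is \<open>return_spmf m\<close>.\<close>
  also have "\<dots> = (if guard_sem I b m
      then lub_spmf (range (\<lambda>i. bind_spmf (sem I C m) (\<lambda>m'. ?w i m'))) else return_spmf m)"
    by simp
  also have "lub_spmf (range (\<lambda>i. bind_spmf (sem I C m) (\<lambda>m'. ?w i m'))) =
      bind_spmf (sem I C m) (\<lambda>m'. lub_spmf (range (\<lambda>i. ?w i m')))"
    by (rule bind_lub_spmf2[OF chain_nat while_approx_mono, symmetric])
  finally show ?thesis
    by (simp only: sem_While[symmetric])
qed

text \<open>The second component is almost surely \<open>Some m\<^sub>2\<close>, so the expectation
  depends on the first marginal alone.\<close>

lemma star_expectation_return_spmf: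
  assumes "star_coupling \<mu> d (return_spmf m\<^sub>2)"
  shows "star_expectation \<mu> f = (\<integral>\<^sup>+ m. f (m, m\<^sub>2) \<partial>measure_spmf d)"
proof -
  have d: "d = map_pmf fst \<mu>" and snd: "map_pmf snd \<mu> = return_spmf m\<^sub>2"
    using assms by (auto simp: star_coupling_def)
  have "snd p = Some m\<^sub>2" if "p \<in> set_pmf \<mu>" for p
    using that arg_cong[OF snd, of set_pmf] by auto
  then have "star_expectation \<mu> f = (\<integral>\<^sup>+ p. star_ext f (fst p, Some m\<^sub>2) \<partial>measure_pmf \<mu>)"
    unfolding star_expectation_def
    by (intro nn_integral_cong_AE) (auto simp: AE_measure_pmf_iff)
  also have "\<dots> = (\<integral>\<^sup>+ x. star_ext f (x, Some m\<^sub>2) \<partial>measure_pmf d)"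
    by (simp add: d)
  \<comment> \<open>The indicator absorbs the value 0 at \<open>None\<close>. This is the shape
    produced by \<open>measure_spmf\<close>, which restricts to \<open>range Some\<close> and pushes
    forward along \<open>the\<close>.\<close>
  also have "\<dots> = (\<integral>\<^sup>+ x. f (the x, m\<^sub>2) * indicator (range Some) x \<partial>measure_pmf d)"
    by (intro nn_integral_cong) (auto split: split_indicator elim: option.exhaust
        simp: notin_range_Some)
  also have "\<dots> = (\<integral>\<^sup>+ m. f (m, m\<^sub>2) \<partial>measure_spmf d)"
    by (simp add: measure_spmf_def nn_integral_distr nn_integral_restrict_space)
  finally show ?thesis .
qed

lemma wp_left_le_if_valid:
  assumes "valid I Z \<Phi> C Skip \<Psi>" "z \<in> Z"
  shows "wp_left I C \<Psi> z m \<le> \<Phi> z m"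
proof (cases m)
  case (Pair m\<^sub>1 m\<^sub>2)
  obtain \<mu> where "star_coupling \<mu> (sem I C m\<^sub>1) (return_spmf m\<^sub>2)"
      "star_expectation \<mu> (\<Psi> z) \<le> \<Phi> z (m\<^sub>1, m\<^sub>2)"
    using assms unfolding valid_def by (metis sem_simps(1))
  then show ?thesis
    by (simp add: star_expectation_return_spmf wp_left_def Pair)
qed

lemma star_expectation_mono:
  assumes "\<And>p. f p \<le> g p"
  shows "star_expectation \<mu> f \<le> star_expectation \<mu> g"
  unfolding star_expectation_def
proof (rule nn_integral_mono)
  show "star_ext f p \<le> star_ext g p" for p
    by (cases "(f, p)" rule: star_ext.cases) (simp_all add: assms)
qed

text \<open>The pointwise rule of consequence is \<open>Conseq\<close> with \<open>Z' = Z\<close>: a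
  smaller postcondition lowers the infimum over star-couplings.\<close>

lemma erhl_mono:
  assumes "erhl I Z \<Phi>' C D \<Psi>'"
    and "\<And>z m. z \<in> Z \<Longrightarrow> \<Phi>' z m \<le> \<Phi> z m"
    and "\<And>z m. z \<in> Z \<Longrightarrow> \<Psi> z m \<le> \<Psi>' z m"
  shows "erhl I Z \<Phi> C D \<Psi>"
proof (rule erhl.Conseq[OF erhl_nonempty[OF assms(1)] assms(1)], intro impI ballI)
  fix m\<^sub>1 m\<^sub>2 z and d\<^sub>1 d\<^sub>2 :: "('a, 'b) mem spmf"
  let ?S = "{\<mu>. star_coupling \<mu> d\<^sub>1 d\<^sub>2}"
  assume *: "\<forall>z' \<in> Z. (INF \<mu> \<in> ?S. star_expectation \<mu> (\<Psi>' z')) \<le> \<Phi>' z' (m\<^sub>1, m\<^sub>2)"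
    and z: "z \<in> Z"
  have "(INF \<mu> \<in> ?S. star_expectation \<mu> (\<Psi> z)) \<le> (INF \<mu> \<in> ?S. star_expectation \<mu> (\<Psi>' z))"
    by (rule INF_mono') (rule star_expectation_mono[OF assms(3)[OF z]])
  also have "\<dots> \<le> \<Phi>' z (m\<^sub>1, m\<^sub>2)"
    using * z by blast
  also have "\<dots> \<le> \<Phi> z (m\<^sub>1, m\<^sub>2)"
    by (rule assms(2)[OF z])
  finally show "(INF \<mu> \<in> ?S. star_expectation \<mu> (\<Psi> z)) \<le> \<Phi> z (m\<^sub>1, m\<^sub>2)" .
qed

text \<open>The induction generalises \<open>\<Psi>\<close> because sequencing and loops apply the
  hypothesis to postconditions that are themselves pre-expectations.\<close>

lemma erhl_wp_left:
  assumes "Z \<noteq> {}"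
  shows "erhl I Z (wp_left I C \<Psi>) C Skip \<Psi>"
proof (induction C arbitrary: \<Psi>)
  case Skip
  show ?case
    by (rule erhl_mono[OF erhl.Skip[OF assms]])
      (auto simp: wp_left_def nn_integral_return_spmf)
next
  case (Assign x e)
  show ?case
    by (rule erhl_mono[OF erhl.AsgnL[OF assms]])
      (auto simp: wp_left_def nn_integral_return_spmf)
next
  case (Sample x s)
  show ?case
    by (rule erhl_mono[OF erhl.SampleL[OF assms]]) (auto simp: wp_left_def o_def)
next
  case (Seq C D)
  have "wp_left I C (wp_left I D \<Psi>) = wp_left I (C ;; D) \<Psi>"
    by (auto simp: wp_left_def nn_integral_bind_spmf fun_eq_iff)
  \<comment> \<open>The rule yields \<open>Skip ;; Skip\<close> on the right, which the unit law
    collapses.\<close>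
  with erhl.Seq[OF Seq.IH(1) Seq.IH(2)] show ?case
    by (metis Skip_Seq)
next
  case (Cond b C D)
  \<comment> \<open>Each branch has only to be compared where its guard condition holds; elsewhere
    the restricted precondition is infinite.\<close>
  show ?case
    by (intro erhl.IfL erhl_mono[OF Cond.IH(1)] erhl_mono[OF Cond.IH(2)])
      (auto simp: wp_left_def restrict_to_def)
next
  case (While b C)
  let ?inv = "wp_left I (While b C) \<Psi>"
  have unfold: "?inv z (m\<^sub>1, m\<^sub>2) =
      (if guard_sem I b m\<^sub>1 then wp_left I C ?inv z (m\<^sub>1, m\<^sub>2) else \<Psi> z (m\<^sub>1, m\<^sub>2))" for z m\<^sub>1 m\<^sub>2
    using sem_While_unfold[of I b C m\<^sub>1]
    by (simp add: wp_left_def nn_integral_bind_spmf nn_integral_return_spmf)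
  \<comment> \<open>Under the guard \<open>unfold\<close> makes this an equality; otherwise the
    right side is infinite.\<close>
  have "wp_left I C ?inv z m \<le> ((\<lambda>(m\<^sub>1, m\<^sub>2). guard_sem I b m\<^sub>1) \<triangleright> ?inv) z m" for z m
    by (cases m) (simp add: restrict_to_def unfold)
  then have "erhl I Z ((\<lambda>(m\<^sub>1, m\<^sub>2). guard_sem I b m\<^sub>1) \<triangleright> ?inv) C Skip ?inv"
    by (rule erhl_mono[OF While.IH]) simp
  then show ?case
  proof (rule erhl_mono[OF erhl.WhileL])
    \<comment> \<open>On exit the invariant equals \<open>\<Psi>\<close>; under the guard the right
      side is infinite.\<close>
    show "\<Psi> z m \<le> ((\<lambda>(m\<^sub>1, m\<^sub>2). \<not> guard_sem I b m\<^sub>1) \<triangleright> ?inv) z m" for z m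
      by (cases m) (simp add: restrict_to_def unfold)
  qed simp
qed

theorem theorem4p5:
  fixes I :: "('x::countable, 'v::countable, 'e, 'b, 's) interp"
    and Z :: "('x, 'v, 'u) index set"
    and \<Phi> \<Psi> :: "(('x, 'v, 'u) index, 'x, 'v) assertion"
    and C :: "('x, 'e, 'b, 's) stmt"
  assumes "Z \<noteq> {}"
    and "valid I Z \<Phi> C Skip \<Psi>"
  shows "erhl I Z \<Phi> C Skip \<Psi>"
  using erhl_wp_left[OF assms(1)] wp_left_le_if_valid[OF assms(2)] by (rule erhl_mono) simp_all

end
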